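(* The value of $\mathrm{cdim}(G)-\mathrm{cdim}(G-e)$ can be arbitrarily large, as $G$ varies; that is, for every integer $N$ there exist a connected graph $G$ and an edge $e$ of $G$ such that $G-e$ is connected and $\mathrm{cdim}(G)-\mathrm{cdim}(G-e)\ge N$.
   Context: All graphs are finite, simple, undirected, of order at least two. $G-e$ is the graph obtained by deleting the edge $e$ (keeping all vertices). A set $S\subseteq V(G)$ is a resolving set of a connected graph $G$ if for every pair of distinct vertices $x,y$ of $G$ there is $z\in S$ with $d(x,z)\ne d(y,z)$ ($d$ is the shortest-path distance); it is a connected resolving set if moreover the induced subgraph $G[S]$ is connected. $\mathrm{cdim}(G)$ is the minimum cardinality of a connected resolving set of $G$. *)

theory Defs
  imports "Graph_Theory.Graph_Theory"
begin

text \<open>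
  A finite simple undirected graph is a \<^locale>\<open>pair_graph\<close>: a finite vertex set together with a
  loop-free symmetric set of vertex pairs. The undirected edge between u and v is represented by
  both arcs (u, v) and (v, u), so deleting an edge removes both.
\<close>

definition delete_edge :: "'a pair_pre_digraph \<Rightarrow> 'a \<times> 'a \<Rightarrow> 'a pair_pre_digraph" where
  "delete_edge G e =
     \<lparr> pverts = pverts G, parcs = parcs G - {(fst e, snd e), (snd e, fst e)} \<rparr>"

definition graph_dist :: "'a pair_pre_digraph \<Rightarrow> 'a \<Rightarrow> 'a \<Rightarrow> ereal" where
  "graph_dist G x y = wf_digraph.\<mu> (with_proj G) (\<lambda>_. 1) x y"

definition resolving_set :: "'a pair_pre_digraph \<Rightarrow> 'a set \<Rightarrow> bool" where
  "resolving_set G S \<longleftrightarrow>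
     S \<subseteq> pverts G \<and>
     (\<forall>x \<in> pverts G. \<forall>y \<in> pverts G. x \<noteq> y \<longrightarrow>
        (\<exists>z \<in> S. graph_dist G x z \<noteq> graph_dist G y z))"

definition connected_resolving_set :: "'a pair_pre_digraph \<Rightarrow> 'a set \<Rightarrow> bool" where
  "connected_resolving_set G S \<longleftrightarrow> resolving_set G S \<and> connected (with_proj G \<restriction> S)"

text \<open>
  The minimum is attained whenever G is connected, since the full vertex set is then a connected
  resolving set; only connected graphs are considered.
\<close>

definition cdim :: "'a pair_pre_digraph \<Rightarrow> nat" where
  "cdim G = (LEAST k. \<exists>S. connected_resolving_set G S \<and> card S = k)"

end

theory Submission
  imports Defs
begin

text \<open>
  Two vertices are twins if they have the same neighbours apart from each other. Twins have the same
  distance to every third vertex, so every resolving set contains one vertex of each twin pair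
  (\<open>resolving_set_meets_twins\<close>).

  Take a long path with vertices \<open>0, \<dots>, k + 2\<close>, hang a further leaf \<open>k + 3\<close> on the vertex \<open>1\<close>, and add
  the chord \<open>e = (k, k + 2)\<close>. The leaves \<open>0\<close> and \<open>k + 3\<close> at one end are twins, and the chord
  closes a triangle in which \<open>k + 1\<close> and \<open>k + 2\<close> are twins. A connected resolving set therefore has
  vertices at both ends and, being connected, meets every level in between
  (\<open>connected_meets_level\<close>): it has at least \<open>k + 2\<close> elements (\<open>cdim_chord_graph\<close>).

  Without the chord the far end is just the end of a path, whose vertices are told apart by their
  distance to \<open>0\<close>. The only pair with equal distance to \<open>0\<close> is then \<open>2\<close> and \<open>k + 3\<close>, which \<open>2\<close>
  separates, so the connected set \<open>{0, 1, 2}\<close> resolves the graph (\<open>cdim_fork_graph\<close>). Hence the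
  difference is at least \<open>k - 1\<close>.
\<close>

section \<open>Connectedness and levels\<close>

lemma connectedI_descent:
  fixes f :: "'a \<Rightarrow> nat"
  assumes r: "r \<in> verts H"
    and descent: "\<And>v. v \<in> verts H \<Longrightarrow> v \<noteq> r \<Longrightarrow> \<exists>w \<in> verts H. f w < f v \<and> (v, w) \<in> arcs_ends H"
  shows "connected H"
proof -
  let ?R = "rtrancl_on (verts H) ((arcs_ends H)\<^sup>s)"
  have to_root: "(v, r) \<in> ?R" if "v \<in> verts H" for v
    using that
  proof (induction "f v" arbitrary: v rule: less_induct)
    case less
    show ?case
    proof (cases "v = r")
      case True
      then show ?thesis using r by auto
    next
      case False
      then obtain w where w: "w \<in> verts H" "f w < f v" "(v, w) \<in> arcs_ends H"
        using descent less.prems by blast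
      then have "(w, r) \<in> ?R"
        using less.hyps by blast
      then show ?thesis
        using w less.prems by (auto intro: converse_rtrancl_on_into_rtrancl_on simp: symcl_def)
    qed
  qed
  have "sym ?R"
    by (rule rtrancl_on_sym) (auto simp: sym_def symcl_def)
  then have "(u, v) \<in> ?R" if "u \<in> verts H" "v \<in> verts H" for u v
    using to_root that by (meson rtrancl_on_trans symE)
  then show ?thesis
    using r by (auto simp: connected_conv)
qed

text \<open>
  A discrete intermediate value theorem: along a walk the level changes by at most one per step,
  so it cannot jump over a value.
\<close>

lemma connected_meets_level:
  fixes f :: "'a \<Rightarrow> nat"
  assumes "connected H" "a \<in> verts H" "b \<in> verts H" "f a \<le> l" "l \<le> f b"
    and step: "\<And>u v. (u, v) \<in> (arcs_ends H)\<^sup>s \<Longrightarrow> f v \<le> Suc (f u)"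
  shows "\<exists>v \<in> verts H. f v = l"
proof -
  have "(a, b) \<in> rtrancl_on (verts H) ((arcs_ends H)\<^sup>s)"
    using assms by (auto simp: connected_conv)
  then have "l \<le> f b \<longrightarrow> (\<exists>v \<in> verts H. f v = l)"
  proof (induction rule: rtrancl_on_induct)
    case base
    then show ?case using assms by (metis le_antisym)
  next
    case (step x y)
    then show ?case
      using assms(6)[of x y] by (metis le_antisym not_less_eq_eq order_trans)
  qed
  then show ?thesis using assms by blast
qed

section \<open>Distances in a pair digraph\<close>

context pair_wf_digraph
begin

lemma awalk_cost_one: "awalk_cost (\<lambda>_. 1) p = length p"
  by (induction p) auto

lemma graph_dist_le:
  assumes "awalk u p v"
  shows "graph_dist G u v \<le> length p"
  using min_cost_le_walk_cost[OF assms, of "\<lambda>_. 1"]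
  by (simp add: graph_dist_def awalk_cost_one)

lemma le_graph_dist:
  assumes "\<And>p. awalk u p v \<Longrightarrow> m \<le> ereal (length p)"
  shows "m \<le> graph_dist G u v"
  unfolding graph_dist_def \<mu>_def using assms
  by (auto simp: awalk_cost_one intro!: INF_greatest)

lemma graph_dist_eq_0_iff:
  assumes "u \<in> pverts G"
  shows "graph_dist G u v = 0 \<longleftrightarrow> u = v"
proof
  assume "u = v"
  then have "awalk u [] v"
    using assms by (simp add: awalk_Nil_iff)
  then have "graph_dist G u v \<le> 0"
    using graph_dist_le[of u "[]" v] by (simp add: zero_ereal_def)
  moreover have "0 \<le> graph_dist G u v"
    by (rule le_graph_dist) simp
  ultimately show "graph_dist G u v = 0"
    by simp
next
  assume dist: "graph_dist G u v = 0"
  show "u = v"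
  proof (rule ccontr)
    assume "u \<noteq> v"
    have "1 \<le> graph_dist G u v"
    proof (rule le_graph_dist)
      fix p assume "awalk u p v"
      with \<open>u \<noteq> v\<close> show "1 \<le> ereal (length p)"
        by (cases p) (auto simp: awalk_Nil_iff)
    qed
    with dist show False by simp
  qed
qed

text \<open>
  A certificate for distances: the Lipschitz condition makes every walk to the root at least as long
  as the level drop, and repeatedly stepping down one level gives a walk of exactly that length.
\<close>

lemma graph_dist_eq_level:
  fixes f :: "'a \<Rightarrow> nat"
  assumes r: "r \<in> pverts G" "f r = 0"
    and lipschitz: "\<And>u v. (u, v) \<in> parcs G \<Longrightarrow> f u \<le> Suc (f v)"
    and descent: "\<And>v. v \<in> pverts G \<Longrightarrow> v \<noteq> r \<Longrightarrow> \<exists>w. f v = Suc (f w) \<and> (v, w) \<in> parcs G"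
    and v: "v \<in> pverts G"
  shows "graph_dist G v r = f v"
proof (rule antisym)
  have "\<exists>p. awalk v p r \<and> length p = f v"
    using v
  proof (induction "f v" arbitrary: v)
    case 0
    then have "v = r" using descent by fastforce
    then show ?case using r by (auto simp: awalk_Nil_iff)
  next
    case (Suc m)
    then have "v \<noteq> r" using r by auto
    then obtain w where w: "f v = Suc (f w)" "(v, w) \<in> parcs G"
      using descent Suc.prems by blast
    then obtain p where "awalk w p r" "length p = f w"
      using Suc.hyps in_arcsD2 by (metis nat.inject)
    then have "awalk v ((v, w) # p) r \<and> length ((v, w) # p) = f v"
      using w in_arcsD1 by (auto simp: awalk_Cons_iff)
    then show ?case by blast
  qed
  then show "graph_dist G v r \<le> f v"
    using graph_dist_le by metis
next
  show "ereal (f v) \<le> graph_dist G v r"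
  proof (rule le_graph_dist)
    fix p assume "awalk v p r"
    then have "f v \<le> length p"
    proof (induction p arbitrary: v)
      case Nil
      then show ?case using r by (simp add: awalk_Nil_iff)
    next
      case (Cons e p)
      then have e: "e \<in> parcs G" "fst e = v" "awalk (snd e) p r"
        by (auto simp: awalk_Cons_iff)
      have "f v \<le> Suc (f (snd e))"
        using lipschitz[of v "snd e"] e by (metis prod.collapse)
      then show ?case using Cons.IH[OF e(3)] by simp
    qed
    then show "ereal (f v) \<le> ereal (length p)" by simp
  qed
qed

section \<open>Twins\<close>

text \<open>
  Redirecting the first arc of a walk from \<open>v\<close> makes it start at \<open>u\<close>, unless that arc leads to \<open>u\<close>,
  in which case it can be dropped.
\<close>

lemma graph_dist_twin_le:
  assumes u: "u \<in> pverts G" and nbrs: "\<And>w. (v, w) \<in> parcs G \<Longrightarrow> w \<noteq> u \<Longrightarrow> (u, w) \<in> parcs G"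
    and z: "z \<noteq> v"
  shows "graph_dist G u z \<le> graph_dist G v z"
proof (rule le_graph_dist)
  fix p assume p: "awalk v p z"
  with z obtain e q where p_eq: "p = e # q"
    by (cases p) (auto simp: awalk_Nil_iff)
  with p have e: "(v, snd e) \<in> parcs G" and q: "awalk (snd e) q z"
    by (auto simp: awalk_Cons_iff)
  have "\<exists>p'. awalk u p' z \<and> length p' \<le> length p"
  proof (cases "snd e = u")
    case True
    with q show ?thesis using p_eq by auto
  next
    case False
    with e have "(u, snd e) \<in> parcs G" using nbrs by blast
    with q u have "awalk u ((u, snd e) # q) z" by (simp add: awalk_Cons_iff)
    then show ?thesis using p_eq by fastforce
  qed
  then show "graph_dist G u z \<le> ereal (length p)"
    using graph_dist_le by (meson ereal_less_eq(3) of_nat_le_iff order_trans)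
qed

lemma resolving_set_meets_twins:
  assumes "resolving_set G S" "u \<in> pverts G" "v \<in> pverts G" "u \<noteq> v"
    and twins: "\<And>w. w \<noteq> u \<Longrightarrow> w \<noteq> v \<Longrightarrow> (u, w) \<in> parcs G \<longleftrightarrow> (v, w) \<in> parcs G"
    and "(u, u) \<notin> parcs G" "(v, v) \<notin> parcs G"
  shows "u \<in> S \<or> v \<in> S"
proof (rule ccontr)
  assume S: "\<not> (u \<in> S \<or> v \<in> S)"
  obtain z where z: "z \<in> S" "graph_dist G u z \<noteq> graph_dist G v z"
    using assms(1-4) unfolding resolving_set_def by blast
  then have "z \<noteq> u" "z \<noteq> v" using S by auto
  then have "graph_dist G u z = graph_dist G v z"
    using assms by (intro antisym graph_dist_twin_le) metis+
  with z show False by simp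
qed

lemma resolving_set_pverts: "resolving_set G (pverts G)"
  unfolding resolving_set_def by (metis graph_dist_eq_0_iff order_refl)

end

section \<open>Bounds on the connected metric dimension\<close>

lemma cdim_le:
  assumes "connected_resolving_set G S"
  shows "cdim G \<le> card S"
  unfolding cdim_def using assms by (blast intro: Least_le)

lemma le_cdim:
  assumes "connected_resolving_set G T"
    and "\<And>S. connected_resolving_set G S \<Longrightarrow> m \<le> card S"
  shows "m \<le> cdim G"
proof -
  have "\<exists>S. connected_resolving_set G S \<and> card S = cdim G"
    unfolding cdim_def by (rule LeastI_ex) (use assms(1) in blast)
  then show ?thesis using assms(2) by metis
qed

section \<open>The forked path with a triangle at its far end\<close>

definition fork_edge :: "nat \<Rightarrow> nat \<Rightarrow> nat \<Rightarrow> bool" where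
  "fork_edge k u v \<longleftrightarrow> (v = Suc u \<and> u \<le> k + 1) \<or> (u = 1 \<and> v = k + 3)"

definition fork_graph :: "nat \<Rightarrow> nat pair_pre_digraph" where
  "fork_graph k =
     \<lparr> pverts = {..k + 3}, parcs = {(u, v). fork_edge k u v \<or> fork_edge k v u} \<rparr>"

definition chord_graph :: "nat \<Rightarrow> nat pair_pre_digraph" where
  "chord_graph k =
     \<lparr> pverts = {..k + 3}, parcs = parcs (fork_graph k) \<union> {(k, k + 2), (k + 2, k)} \<rparr>"

lemma delete_chord: "delete_edge (chord_graph k) (k, k + 2) = fork_graph k"
  by (auto simp: delete_edge_def chord_graph_def fork_graph_def fork_edge_def)

lemma pair_graph_chord_graph: "pair_graph (chord_graph k)"
proof -
  have "parcs (chord_graph k) \<subseteq> {..k + 3} \<times> {..k + 3}"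
    by (auto simp: chord_graph_def fork_graph_def fork_edge_def)
  then have "finite (parcs (chord_graph k))"
    by (rule finite_subset) simp
  then show ?thesis
    by unfold_locales
      (auto simp: chord_graph_def fork_graph_def fork_edge_def symmetric_def sym_def)
qed

lemma pair_wf_digraph_fork_graph: "pair_wf_digraph (fork_graph k)"
  by unfold_locales (auto simp: fork_graph_def fork_edge_def)

text \<open>
  The distance to \<open>0\<close> in the graph without the chord; the extra leaf reaches \<open>0\<close> through \<open>1\<close>.
\<close>

definition fork_level :: "nat \<Rightarrow> nat \<Rightarrow> nat" where
  "fork_level k v = (if v = k + 3 then 2 else v)"

lemma fork_level_descent:
  assumes "v \<le> k + 3" "v \<noteq> 0"
  shows "\<exists>w \<le> k + 3. w < v \<and> fork_level k v = Suc (fork_level k w) \<and>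
           (v, w) \<in> parcs (fork_graph k)"
proof (cases "v = k + 3")
  case True
  then show ?thesis by (intro exI[of _ 1]) (auto simp: fork_level_def fork_graph_def fork_edge_def)
next
  case False
  then show ?thesis using assms
    by (intro exI[of _ "v - 1"]) (auto simp: fork_level_def fork_graph_def fork_edge_def)
qed

lemma pverts_fork_graph: "pverts (fork_graph k) = {..k + 3}"
  by (simp add: fork_graph_def)

lemma arcs_ends_induce: "arcs_ends (with_proj G \<restriction> S) = parcs G \<inter> S \<times> S"
  by (auto simp: arcs_ends_conv induce_subgraph_def with_proj_def image_iff)

lemma fork_graph_dist_0:
  assumes "v \<le> k + 3"
  shows "graph_dist (fork_graph k) v 0 = fork_level k v"
proof (rule pair_wf_digraph.graph_dist_eq_level[OF pair_wf_digraph_fork_graph])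
  show "\<exists>w. fork_level k v = Suc (fork_level k w) \<and> (v, w) \<in> parcs (fork_graph k)"
    if "v \<in> pverts (fork_graph k)" "v \<noteq> 0" for v
    using that fork_level_descent[of v k] by (auto simp: pverts_fork_graph)
qed (use assms in \<open>auto simp: fork_level_def fork_graph_def fork_edge_def split: if_splits\<close>)

lemma connected_fork_graph: "connected (with_proj (fork_graph k))"
proof (rule connectedI_descent[where r = 0 and f = id])
  show "\<exists>w \<in> verts (with_proj (fork_graph k)). id w < id v \<and> (v, w) \<in> arcs_ends (with_proj (fork_graph k))"
    if "v \<in> verts (with_proj (fork_graph k))" "v \<noteq> 0" for v
    using that fork_level_descent[of v k] by (auto simp: pverts_fork_graph)
qed (simp add: pverts_fork_graph)

lemma connected_chord_graph: "connected (with_proj (chord_graph k))"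
proof (rule connectedI_descent[where r = 0 and f = id])
  show "\<exists>w \<in> verts (with_proj (chord_graph k)). id w < id v \<and> (v, w) \<in> arcs_ends (with_proj (chord_graph k))"
    if "v \<in> verts (with_proj (chord_graph k))" "v \<noteq> 0" for v
    using that fork_level_descent[of v k] by (auto simp: chord_graph_def)
qed (simp add: chord_graph_def)

text \<open>
  Distance to \<open>0\<close> identifies all vertices except \<open>2\<close> and the extra leaf; adding \<open>2\<close> separates these,
  and \<open>1\<close> joins the two landmarks.
\<close>

lemma cdim_fork_graph: "cdim (fork_graph k) \<le> 3"
proof -
  let ?F = "fork_graph k"
  interpret pair_wf_digraph ?F by (rule pair_wf_digraph_fork_graph)
  have "resolving_set ?F {0, 1, 2}"
    unfolding resolving_set_def
  proof (intro conjI ballI impI)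
    show "{0, 1, 2} \<subseteq> pverts ?F" by (auto simp: pverts_fork_graph)
  next
    fix x y assume xy: "x \<in> pverts ?F" "y \<in> pverts ?F" "x \<noteq> y"
    show "\<exists>z \<in> {0, 1, 2}. graph_dist ?F x z \<noteq> graph_dist ?F y z"
    proof (cases "fork_level k x = fork_level k y")
      case True
      then have "x = 2 \<or> y = 2"
        using xy by (auto simp: fork_level_def split: if_splits)
      then show ?thesis
        using xy graph_dist_eq_0_iff by (metis insertCI)
    next
      case False
      then show ?thesis
        using xy by (auto simp: fork_graph_dist_0 pverts_fork_graph)
    qed
  qed
  moreover have "connected (with_proj ?F \<restriction> {0, 1, 2})"
    by (rule connectedI_descent[where r = 0 and f = id])
      (auto simp: arcs_ends_induce fork_graph_def fork_edge_def)
  ultimately show ?thesis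
    using cdim_le[of ?F "{0, 1, 2}"] by (simp add: connected_resolving_set_def)
qed

text \<open>
  The twins at both ends force a connected resolving set to reach from one end to the other, so it
  has a vertex in each of the \<open>k + 2\<close> levels.
\<close>

lemma cdim_chord_graph:
  assumes "1 \<le> k"
  shows "k + 2 \<le> cdim (chord_graph k)"
proof (rule le_cdim)
  let ?G = "chord_graph k"
  interpret pair_graph ?G by (rule pair_graph_chord_graph)
  have "with_proj ?G \<restriction> pverts ?G = with_proj ?G"
    using in_arcsD1 in_arcsD2 by (auto simp: induce_subgraph_def with_proj_def)
  then show "connected_resolving_set ?G (pverts ?G)"
    using connected_chord_graph[of k] resolving_set_pverts
    by (simp add: connected_resolving_set_def)
next
  let ?G = "chord_graph k"
  interpret pair_graph ?G by (rule pair_graph_chord_graph)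
  have vertex: "v \<in> pverts ?G \<longleftrightarrow> v \<le> k + 3" for v
    by (simp add: chord_graph_def)
  have arc: "(u, v) \<in> parcs ?G \<longleftrightarrow>
      u = k \<and> v = k + 2 \<or> u = k + 2 \<and> v = k \<or> fork_edge k u v \<or> fork_edge k v u" for u v
    by (simp add: chord_graph_def fork_graph_def)
  have near_nbrs: "(0, w) \<in> parcs ?G \<longleftrightarrow> w = 1" "(k + 3, w) \<in> parcs ?G \<longleftrightarrow> w = 1" for w
    using assms unfolding arc fork_edge_def by linarith+
  have far_nbrs: "(k + 1, w) \<in> parcs ?G \<longleftrightarrow> w = k \<or> w = k + 2"
    "(k + 2, w) \<in> parcs ?G \<longleftrightarrow> w = k \<or> w = k + 1" for w
    using assms unfolding arc fork_edge_def by linarith+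
  fix S assume "connected_resolving_set ?G S"
  then have S: "resolving_set ?G S" and conn: "connected (with_proj ?G \<restriction> S)"
    by (auto simp: connected_resolving_set_def)
  have "0 \<in> S \<or> k + 3 \<in> S"
    by (rule resolving_set_meets_twins[OF S]) (simp_all add: vertex near_nbrs)
  then obtain a where a: "a \<in> S" "a = 0 \<or> a = k + 3" by blast
  have "k + 1 \<in> S \<or> k + 2 \<in> S"
    by (rule resolving_set_meets_twins[OF S]) (simp_all add: vertex far_nbrs[simplified])
  then obtain b where b: "b \<in> S" "b = k + 1 \<or> b = k + 2" by blast
  \<comment> \<open>Giving twins the same level makes the level change by at most one along the chord as well.\<close>
  define f where "f v = (if v = k + 3 then 0 else min v (k + 1))" for v
  have "l \<in> f ` S" if "l \<le> k + 1" for l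
  proof -
    have "\<exists>v \<in> verts (with_proj ?G \<restriction> S). f v = l"
    proof (rule connected_meets_level[OF conn, where a = a and b = b])
      show "f v \<le> Suc (f u)" if "(u, v) \<in> (arcs_ends (with_proj ?G \<restriction> S))\<^sup>s" for u v
      proof -
        have "(u, v) \<in> parcs ?G"
          using that arcs_symmetric by (auto simp: arcs_ends_induce symcl_def)
        then show ?thesis
          using assms unfolding arc fork_edge_def f_def by (elim disjE conjE) simp_all
      qed
    qed (use a b that in \<open>auto simp: f_def\<close>)
    then show ?thesis by auto
  qed
  then have "{..k + 1} \<subseteq> f ` S" by auto
  moreover have "finite S"
    using S pair_finite_verts by (auto simp: resolving_set_def intro: finite_subset)
  ultimately have "card {..k + 1} \<le> card S"
    by (meson surj_card_le)
  then show "k + 2 \<le> card S" by simp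
qed

theorem mainTheorem19:
  fixes N :: int
  shows "\<exists>(G :: nat pair_pre_digraph) e.
           pair_graph G \<and> 2 \<le> card (pverts G) \<and> connected (with_proj G) \<and>
           e \<in> parcs G \<and> connected (with_proj (delete_edge G e)) \<and>
           int (cdim G) - int (cdim (delete_edge G e)) \<ge> N"
proof -
  define k where "k = nat N + 1"
  have k: "1 \<le> k" "N \<le> int k - 1" by (auto simp: k_def)
  have "N \<le> int (cdim (chord_graph k)) - int (cdim (fork_graph k))"
    using cdim_fork_graph[of k] cdim_chord_graph[OF k(1)] k(2) by linarith
  moreover have "2 \<le> card (pverts (chord_graph k))" "(k, k + 2) \<in> parcs (chord_graph k)"
    by (auto simp: chord_graph_def)
  ultimately show ?thesis
    using pair_graph_chord_graph[of k] connected_chord_graph[of k] connected_fork_graph[of k]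
      delete_chord[of k]
    by (intro exI[of _ "chord_graph k"] exI[of _ "(k, k + 2)"]) presburger
qed

end
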